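(* Let $\Omega_{\rm ref}=[-1,1]$ and let $\pi_h:H\Lambda^0(\Omega_{\rm ref})\to\Lambda^0_h$ be the Lagrange-interpolation projection of $0$-forms. Then there is a constant $C$, independent of $a^{(0)}$, such that for all $a^{(0)}\in H\Lambda^0(\Omega_{\rm ref})$ $$\|\pi_ha^{(0)}\|_{H\Lambda^0}\le C\,\|a^{(0)}\|_{H\Lambda^0}\qquad\text{and}\qquad |\pi_ha^{(0)}|_{H\Lambda^0}\le C\,|a^{(0)}|_{H\Lambda^0}.$$
   Context: $H\Lambda^0(\Omega_{\rm ref})=\{a\in L^2\Lambda^0:\mathrm da\in L^2\Lambda^1\}$ (the Sobolev space $H^1(-1,1)$), with norm $\|a\|^2_{H\Lambda^0}=\|a\|^2_{L^2\Lambda^0}+\|\mathrm da\|^2_{L^2\Lambda^1}$ and semi-norm $|a|_{H\Lambda^0}=\|\mathrm da\|_{L^2\Lambda^1}$. Given nodes $-1\le\xi_0<\dots<\xi_N\le1$ with Lagrange polynomials $l_i$ of degree $N$ ($l_i(\xi_p)=\delta_{ip}$), the projection is $\pi_ha^{(0)}=\sum_{i=0}^Na^{(0)}(\xi_i)\,l_i$, and $\Lambda^0_h$ is its range. Standing assumption: the nodes are suitably chosen ((extended) Gauss or Gauss–Lobatto points), so that the interpolant obeys the standard a priori error estimate $$\|a^{(0)}-\pi_ha^{(0)}\|_{H\Lambda^0}\le C_0\,\frac{h^{l-1}}{p^{m-1}}\,|a^{(0)}|_{H^m\Lambda^0},\qquad l=\min(p+1,m),$$ for $a^{(0)}\in H^m\Lambda^0$,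 $m\ge1$. Here $h$ is the grid size, $p$ the polynomial degree of the interpolant, $|\cdot|_{H^m\Lambda^0}$ the order-$m$ Sobolev semi-norm (with $|\cdot|_{H^1\Lambda^0}=|\cdot|_{H\Lambda^0}$), and $C_0$ a constant not depending on $a^{(0)}$, $h$, $p$. *)

theory Defs
  imports "HOL-Analysis.Analysis"
begin

text \<open>
  Elements of the Lebesgue and Sobolev spaces are represented by functions, which are to be read
  up to equality almost everywhere on the reference interval. A 1-form \<open>g dx\<close> is identified with
  its coefficient \<open>g\<close>; this preserves the \<open>L\<^sup>2\<close> norm, and the exterior derivative of a 0-form
  becomes its weak derivative.
\<close>

definition Omega_ref :: "real set" where
  "Omega_ref = {-1..1}"

definition L2 :: "(real \<Rightarrow> real) set" where
  "L2 = {f \<in> borel_measurable (lebesgue_on Omega_ref).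
           integrable (lebesgue_on Omega_ref) (\<lambda>x. (f x)\<^sup>2)}"

definition L2_norm :: "(real \<Rightarrow> real) \<Rightarrow> real" where
  "L2_norm f = sqrt (\<integral>x. (f x)\<^sup>2 \<partial>lebesgue_on Omega_ref)"

definition test_function :: "(real \<Rightarrow> real) \<Rightarrow> bool" where
  "test_function \<phi> \<longleftrightarrow>
     (\<forall>k. (deriv ^^ k) \<phi> differentiable_on UNIV) \<and>
     (\<exists>K. compact K \<and> K \<subseteq> interior Omega_ref \<and> (\<forall>x. x \<notin> K \<longrightarrow> \<phi> x = 0))"

definition has_weak_deriv :: "nat \<Rightarrow> (real \<Rightarrow> real) \<Rightarrow> (real \<Rightarrow> real) \<Rightarrow> bool" where
  "has_weak_deriv k f g \<longleftrightarrow>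
     (\<forall>\<phi>. test_function \<phi> \<longrightarrow>
        (\<integral>x. f x * (deriv ^^ k) \<phi> x \<partial>lebesgue_on Omega_ref) =
        (-1) ^ k * (\<integral>x. g x * \<phi> x \<partial>lebesgue_on Omega_ref))"

text \<open>The choice below is unique up to equality almost everywhere on the reference interval.\<close>

definition weak_deriv :: "nat \<Rightarrow> (real \<Rightarrow> real) \<Rightarrow> real \<Rightarrow> real" where
  "weak_deriv k f = (SOME g. g \<in> L2 \<and> has_weak_deriv k f g)"

definition Sobolev :: "nat \<Rightarrow> (real \<Rightarrow> real) set" where
  "Sobolev m = {a \<in> L2. \<forall>k\<in>{1..m}. \<exists>g\<in>L2. has_weak_deriv k a g}"

definition Sobolev_seminorm :: "nat \<Rightarrow> (real \<Rightarrow> real) \<Rightarrow> real" where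
  "Sobolev_seminorm m a = L2_norm (weak_deriv m a)"

text \<open>
  \<open>Sobolev_seminorm m\<close> vanishes on polynomials of degree less than \<open>m\<close>. It can therefore bound the
  error of interpolation by polynomials of degree \<open>p\<close> only if \<open>m \<le> p + 1\<close>.
\<close>

definition H\<Lambda>0 :: "(real \<Rightarrow> real) set" where
  "H\<Lambda>0 = {a \<in> L2. \<exists>g\<in>L2. has_weak_deriv 1 a g}"

definition H\<Lambda>0_seminorm :: "(real \<Rightarrow> real) \<Rightarrow> real" where
  "H\<Lambda>0_seminorm a = L2_norm (weak_deriv 1 a)"

definition H\<Lambda>0_norm :: "(real \<Rightarrow> real) \<Rightarrow> real" where
  "H\<Lambda>0_norm a = sqrt ((L2_norm a)\<^sup>2 + (L2_norm (weak_deriv 1 a))\<^sup>2)"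

text \<open>
  Nodal values of an element of \<open>H\<Lambda>0\<close> are those of its continuous representative, which is unique
  on the closed reference interval.
\<close>

definition cont_rep :: "(real \<Rightarrow> real) \<Rightarrow> real \<Rightarrow> real" where
  "cont_rep a = (SOME b. continuous_on Omega_ref b \<and> (AE x in lebesgue_on Omega_ref. b x = a x))"

definition interpolation_nodes :: "nat \<Rightarrow> (nat \<Rightarrow> real) \<Rightarrow> bool" where
  "interpolation_nodes N \<xi> \<longleftrightarrow> \<xi> ` {..N} \<subseteq> Omega_ref \<and> strict_mono_on {..N} \<xi>"

definition lagrange :: "nat \<Rightarrow> (nat \<Rightarrow> real) \<Rightarrow> nat \<Rightarrow> real \<Rightarrow> real" where
  "lagrange N \<xi> i x = (\<Prod>j\<in>{..N} - {i}. (x - \<xi> j) / (\<xi> i - \<xi> j))"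

lemma lagrange_nodes:
  assumes "interpolation_nodes N \<xi>" "i \<le> N" "j \<le> N"
  shows "lagrange N \<xi> i (\<xi> j) = (if i = j then 1 else 0)"
proof -
  have inj: "inj_on \<xi> {..N}"
    using assms(1) by (auto simp: interpolation_nodes_def intro: strict_mono_on_imp_inj_on)
  show ?thesis
  proof (cases "i = j")
    case True
    have "(\<Prod>k\<in>{..N} - {i}. (\<xi> j - \<xi> k) / (\<xi> i - \<xi> k)) = (\<Prod>k\<in>{..N} - {i}. 1)"
      using inj assms True by (intro prod.cong) (auto dest: inj_onD)
    then show ?thesis using True by (simp add: lagrange_def)
  next
    case False
    then show ?thesis using assms by (auto simp: lagrange_def)
  qed
qed

definition interp :: "nat \<Rightarrow> (nat \<Rightarrow> real) \<Rightarrow> (real \<Rightarrow> real) \<Rightarrow> real \<Rightarrow> real" where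
  "interp N \<xi> a x = (\<Sum>i\<le>N. cont_rep a (\<xi> i) * lagrange N \<xi> i x)"

end

theory Submission
  imports Defs
begin

text \<open>
  For \<open>m = 1\<close> the factor \<open>h\<^sup>l\<^sup>-\<^sup>1 / p\<^sup>m\<^sup>-\<^sup>1\<close> in the a priori estimate is \<open>1\<close>, so the interpolation error is
  bounded by \<open>C\<^sub>0\<close> times the semi-norm of \<open>a\<close>, and both bounds follow with \<open>C = 1 + \<bar>C\<^sub>0\<bar>\<close> from
  the triangle inequality. Since weak derivatives are chosen by \<open>SOME\<close>, that inequality needs
  their uniqueness: a square integrable function orthogonal to all test functions has, by
  dominated convergence along smooth bumps, integral zero over every interval, and therefore
  vanishes almost everywhere.
\<close>

section \<open>Smooth bump functions\<close>

text \<open>\<open>flat_exp 0\<close> is the classical smooth function exp(-1/x), extended by 0 to x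
  <= 0. The powers of 1/x are the factors that differentiation produces.\<close>

definition flat_exp :: "nat \<Rightarrow> real \<Rightarrow> real" where
  "flat_exp k x = (if 0 < x then inverse x ^ k * exp (- inverse x) else 0)"

text \<open>On the right, y = 1/x turns the claim into y^k / exp y -> 0 at infinity; on the left the
  function is constantly 0.\<close>

lemma flat_exp_tendsto_0: "(flat_exp k \<longlongrightarrow> 0) (at 0)"
proof -
  have l: "(flat_exp k \<longlongrightarrow> 0) (at_left 0)"
    by (rule tendsto_eventually) (auto simp: flat_exp_def eventually_at_filter)
  have "((\<lambda>x::real. inverse x ^ k / exp (inverse x)) \<longlongrightarrow> 0) (at_right 0)"
    by (rule filterlim_compose[OF tendsto_power_div_exp_0 filterlim_inverse_at_top_right])
  moreover have "\<forall>\<^sub>F x in at_right 0. inverse x ^ k / exp (inverse x) = flat_exp k x"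
    by (auto simp: flat_exp_def eventually_at_filter exp_minus field_simps)
  ultimately have "(flat_exp k \<longlongrightarrow> 0) (at_right 0)"
    by (rule Lim_transform_eventually)
  with l show ?thesis by (simp add: filterlim_split_at)
qed

lemma DERIV_flat_exp:
  "(flat_exp k has_real_derivative flat_exp (k + 2) x - k * flat_exp (k + 1) x) (at x)"
proof -
  consider "x > 0" | "x < 0" | "x = 0" by linarith
  then show ?thesis
  proof cases
    case 1
    have i: "(inverse has_real_derivative - (inverse x ^ 2)) (at x)"
      using DERIV_inverse[of x UNIV] 1 by (simp add: numeral_2_eq_2)
    have "((\<lambda>x. inverse x ^ k * exp (- inverse x)) has_real_derivative
        real k * (- (inverse x ^ 2) * inverse x ^ (k - Suc 0)) * exp (- inverse x)
        + exp (- inverse x) * (- (- (inverse x ^ 2))) * inverse x ^ k) (at x)"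
      by (intro DERIV_mult DERIV_power DERIV_chain2[OF DERIV_exp] DERIV_minus i)
    \<comment> \<open>The truncated exponent \<open>k - Suc 0\<close> is harmless for k = 0, where
      its coefficient vanishes.\<close>
    also have "real k * (- (inverse x ^ 2) * inverse x ^ (k - Suc 0)) * exp (- inverse x)
        + exp (- inverse x) * (- (- (inverse x ^ 2))) * inverse x ^ k
        = flat_exp (k + 2) x - k * flat_exp (k + 1) x"
      using 1 by (cases k) (simp_all add: flat_exp_def power2_eq_square)
    finally have "((\<lambda>x. inverse x ^ k * exp (- inverse x)) has_real_derivative
        flat_exp (k + 2) x - k * flat_exp (k + 1) x) (at x)" .
    then show ?thesis
      by (rule has_field_derivative_transform_within_open[where S = "{0<..}"])
        (use 1 in \<open>auto simp: flat_exp_def\<close>)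
  next
    case 2
    have "((\<lambda>x. 0) has_real_derivative flat_exp (k + 2) x - k * flat_exp (k + 1) x) (at x)"
      using 2 by (auto simp: flat_exp_def)
    then show ?thesis
      by (rule has_field_derivative_transform_within_open[where S = "{..<0}"])
        (use 2 in \<open>auto simp: flat_exp_def\<close>)
  next
    \<comment> \<open>Since \<open>flat_exp k 0 = 0\<close>, the difference quotient at 0 is exactly
      \<open>flat_exp (k + 1)\<close>, which tends to 0.\<close>
    case 3
    have "\<forall>\<^sub>F y in at 0. flat_exp (k + 1) y = (flat_exp k y - flat_exp k 0) / (y - 0)"
      by (auto simp: flat_exp_def eventually_at_filter divide_inverse mult_ac)
    then have "((\<lambda>y. (flat_exp k y - flat_exp k 0) / (y - 0)) \<longlongrightarrow> 0) (at 0)"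
      by (rule Lim_transform_eventually[OF flat_exp_tendsto_0])
    then show ?thesis
      using 3 by (simp add: has_field_derivative_iff flat_exp_def)
  qed
qed

text \<open>This algebra is closed under differentiation, hence it consists of smooth functions.\<close>

inductive_set flat_algebra :: "(real \<Rightarrow> real) set" where
  flat: "(\<lambda>x. flat_exp k (\<alpha> * x + \<beta>)) \<in> flat_algebra"
| const: "(\<lambda>x. c) \<in> flat_algebra"
| add: "f \<in> flat_algebra \<Longrightarrow> g \<in> flat_algebra \<Longrightarrow> (\<lambda>x. f x + g x) \<in> flat_algebra"
| mult: "f \<in> flat_algebra \<Longrightarrow> g \<in> flat_algebra \<Longrightarrow> (\<lambda>x. f x * g x) \<in> flat_algebra"

lemma flat_algebra_DERIV:
  assumes "f \<in> flat_algebra"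
  shows "\<exists>f'\<in>flat_algebra. \<forall>x. (f has_real_derivative f' x) (at x)"
  using assms
proof induction
  case (flat k \<alpha> \<beta>)
  let ?F = "\<lambda>j x. flat_exp j (\<alpha> * x + \<beta>)"
  \<comment> \<open>The difference is written as a sum with factor \<open>- real k\<close>, so that
    the closure rules of the algebra apply literally.\<close>
  have "((\<lambda>x. ?F k x) has_real_derivative (?F (k + 2) x + (- real k) * ?F (k + 1) x) * \<alpha>) (at x)"
    for x
  proof (rule DERIV_chain2[where f = "flat_exp k" and g = "\<lambda>x. \<alpha> * x + \<beta>"])
    show "((\<lambda>x. \<alpha> * x + \<beta>) has_real_derivative \<alpha>) (at x)"
      by (auto intro!: derivative_eq_intros)
  qed (use DERIV_flat_exp[of k "\<alpha> * x + \<beta>"] in simp)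
  moreover have "(\<lambda>x. (?F (k + 2) x + (- real k) * ?F (k + 1) x) * \<alpha>) \<in> flat_algebra"
    by (intro flat_algebra.intros)
  ultimately show ?case
    by (intro bexI[of _ "\<lambda>x. (?F (k + 2) x + (- real k) * ?F (k + 1) x) * \<alpha>"]) auto
next
  case (const c)
  then show ?case by (intro bexI[of _ "\<lambda>x. 0"]) (auto intro: flat_algebra.intros)
next
  case (add f g)
  then obtain f' g' where "f' \<in> flat_algebra" "g' \<in> flat_algebra"
    and "\<forall>x. (f has_real_derivative f' x) (at x)" "\<forall>x. (g has_real_derivative g' x) (at x)"
    by blast
  then show ?case
    by (intro bexI[of _ "\<lambda>x. f' x + g' x"])
      (auto intro!: flat_algebra.intros derivative_eq_intros)
next
  case (mult f g)
  then obtain f' g' where "f' \<in> flat_algebra" "g' \<in> flat_algebra"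
    and "\<forall>x. (f has_real_derivative f' x) (at x)" "\<forall>x. (g has_real_derivative g' x) (at x)"
    by blast
  with mult show ?case
    by (intro bexI[of _ "\<lambda>x. f' x * g x + g' x * f x"])
      (auto intro!: flat_algebra.intros derivative_eq_intros)
qed

lemma flat_algebra_deriv: "f \<in> flat_algebra \<Longrightarrow> deriv f \<in> flat_algebra"
  using flat_algebra_DERIV[of f] DERIV_imp_deriv by (metis ext)

lemma flat_algebra_differentiable: "f \<in> flat_algebra \<Longrightarrow> f differentiable_on UNIV"
  using flat_algebra_DERIV[of f]
  by (meson differentiable_at_imp_differentiable_on real_differentiable_def)

lemma flat_algebra_test_function:
  assumes "f \<in> flat_algebra" "-1 < c" "d < 1" "\<And>x. x \<notin> {c..d} \<Longrightarrow> f x = 0"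
  shows "test_function f"
proof -
  have "(deriv ^^ k) f \<in> flat_algebra" for k
    by (induction k) (auto simp: assms flat_algebra_deriv)
  moreover have "{c..d} \<subseteq> interior Omega_ref"
    using assms by (auto simp: Omega_ref_def)
  ultimately show ?thesis
    using assms(4) compact_Icc unfolding test_function_def
    by (blast intro: flat_algebra_differentiable)
qed

text \<open>
  The arguments of the two factors are \<open>n (x - a) - 1\<close> and \<open>n (b - x) - 1\<close>; the shift by \<open>1\<close> keeps the
  support away from \<open>a\<close> and \<open>b\<close>, which may be end points of the reference interval.
\<close>

definition bump :: "real \<Rightarrow> real \<Rightarrow> nat \<Rightarrow> real \<Rightarrow> real" where
  "bump a b n x = flat_exp 0 (real n * x + (- real n * a - 1)) *
                  flat_exp 0 (- real n * x + (real n * b - 1))"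

lemma bump_eq_0: "\<lbrakk>0 < n; x \<notin> {a + 1 / n..b - 1 / n}\<rbrakk> \<Longrightarrow> bump a b n x = 0"
  by (auto simp: bump_def flat_exp_def field_simps not_le)

lemma test_function_bump:
  assumes "-1 \<le> a" "b \<le> 1" "0 < n"
  shows "test_function (bump a b n)"
proof (rule flat_algebra_test_function[of _ "a + 1 / n" "b - 1 / n"])
  show "bump a b n \<in> flat_algebra"
    unfolding bump_def[abs_def] by (intro flat_algebra.intros)
  have "0 < 1 / real n" using assms(3) by simp
  then show "-1 < a + 1 / n" "b - 1 / n < 1"
    using assms(1,2) by linarith+
qed (use assms bump_eq_0 in auto)

text \<open>Inside the interval both arguments have the form n s - 1 with s > 0, so both factors
  tend to exp(-0) = 1. Outside, one argument is at most -1 and the product is 0 for every n.\<close>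

lemma bump_tendsto_indicator: "(\<lambda>n. bump a b n x) \<longlonglongrightarrow> indicator {a<..<b} x"
proof (cases "x \<in> {a<..<b}")
  case True
  have lim: "(\<lambda>n. flat_exp 0 (real n * s + - 1)) \<longlonglongrightarrow> 1" if "s > 0" for s
  proof -
    have t: "filterlim (\<lambda>n. real n * s + - 1) at_top sequentially"
      unfolding add.commute[of _ "-1"] mult.commute[of _ s]
      using that by (intro filterlim_tendsto_add_at_top[OF tendsto_const]
          filterlim_tendsto_pos_mult_at_top[OF tendsto_const _ filterlim_real_sequentially])
    have "(\<lambda>n. exp (- inverse (real n * s + - 1))) \<longlonglongrightarrow> exp (- 0)"
      by (intro tendsto_intros tendsto_inverse_0_at_top t)
    moreover have "\<forall>\<^sub>F n in sequentially.
        exp (- inverse (real n * s + - 1)) = flat_exp 0 (real n * s + - 1)"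
      using t[unfolded filterlim_at_top_dense, rule_format, of 0]
      by eventually_elim (simp add: flat_exp_def)
    ultimately show ?thesis
      using Lim_transform_eventually by fastforce
  qed
  have "(\<lambda>n. flat_exp 0 (real n * (x - a) + - 1) * flat_exp 0 (real n * (b - x) + - 1))
      \<longlonglongrightarrow> 1 * 1"
    using True by (intro tendsto_mult lim) auto
  then show ?thesis
    using True by (simp add: bump_def algebra_simps)
next
  case False
  have "bump a b n x = 0" for n
    using False mult_left_mono[of x a "real n"] mult_left_mono[of b x "real n"]
    by (auto simp: bump_def flat_exp_def not_less)
  then show ?thesis using False by simp
qed

text \<open>This provides a majorant independent of n for dominated convergence.\<close>

lemma abs_bump_le_1: "\<bar>bump a b n x\<bar> \<le> 1"
proof -
  have "0 \<le> flat_exp 0 y" "flat_exp 0 y \<le> 1" for y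
    by (auto simp: flat_exp_def)
  then show ?thesis
    unfolding bump_def by (metis abs_mult abs_of_nonneg mult_le_one)
qed


section \<open>Square integrable functions\<close>

abbreviation M\<Omega> :: "real measure" where
  "M\<Omega> \<equiv> lebesgue_on Omega_ref"

lemma L2D:
  assumes "f \<in> L2"
  shows "f \<in> borel_measurable M\<Omega>" "integrable M\<Omega> (\<lambda>x. (f x)\<^sup>2)"
  using assms by (auto simp: L2_def)

text \<open>The majorant comes from |u v| <= u^2 + v^2, a weakened arithmetic-geometric mean
  inequality.\<close>

lemma integrable_mult_L2:
  assumes "f \<in> L2" "g \<in> L2"
  shows "integrable M\<Omega> (\<lambda>x. f x * g x)"
proof (rule Bochner_Integration.integrable_bound)
  show "integrable M\<Omega> (\<lambda>x. (f x)\<^sup>2 + (g x)\<^sup>2)"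
    using L2D[OF assms(1)] L2D[OF assms(2)] by simp
  show "(\<lambda>x. f x * g x) \<in> borel_measurable M\<Omega>"
    using L2D[OF assms(1)] L2D[OF assms(2)] by simp
  have "\<bar>u * v\<bar> \<le> u\<^sup>2 + v\<^sup>2" for u v :: real
    using sum_squares_bound[of "\<bar>u\<bar>" "\<bar>v\<bar>"] mult_nonneg_nonneg[OF abs_ge_zero[of u] abs_ge_zero[of v]]
    unfolding abs_mult power2_abs by linarith
  then show "AE x in M\<Omega>. norm (f x * g x) \<le> norm ((f x)\<^sup>2 + (g x)\<^sup>2)"
    by (auto intro: order_trans)
qed

lemma L2_diff:
  assumes "f \<in> L2" "g \<in> L2"
  shows "(\<lambda>x. f x - g x) \<in> L2"
  using L2D[OF assms(1)] L2D[OF assms(2)] integrable_mult_L2[OF assms]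
  by (auto simp: L2_def power2_diff mult.assoc)

lemma L2_continuous:
  assumes "continuous_on Omega_ref f"
  shows "f \<in> L2"
  using continuous_imp_integrable_real[of "-1" 1 f]
    continuous_imp_integrable_real[of "-1" 1 "\<lambda>x. (f x)\<^sup>2"] assms
  by (auto simp: L2_def Omega_ref_def intro!: continuous_intros)

text \<open>The reference interval is bounded, so the constant 1 is square integrable and can serve
  as the second factor.\<close>

lemma integrable_L2:
  assumes "f \<in> L2"
  shows "integrable M\<Omega> f"
  using integrable_mult_L2[OF assms, of "\<lambda>_. 1"] L2_continuous[of "\<lambda>_. 1"] by simp

lemma L2_norm_nonneg: "0 \<le> L2_norm f"
  by (simp add: L2_norm_def)

lemma L2_norm_cong_AE:
  assumes "f \<in> L2" "g \<in> L2" "AE x in M\<Omega>. f x = g x"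
  shows "L2_norm f = L2_norm g"
proof -
  have "(\<integral>x. (f x)\<^sup>2 \<partial>M\<Omega>) = (\<integral>x. (g x)\<^sup>2 \<partial>M\<Omega>)"
    using assms L2D by (intro integral_cong_AE) auto
  then show ?thesis by (simp add: L2_norm_def)
qed

text \<open>
  The weighted Young inequality \<open>(u - v)\<^sup>2 \<le> (1 + B / A) u\<^sup>2 + (1 + A / B) v\<^sup>2\<close> integrates to
  \<open>(A + B)\<^sup>2\<close> when \<open>A\<close> and \<open>B\<close> bound the two norms; the slack \<open>e\<close> keeps them positive.
\<close>

lemma L2_norm_diff_le:
  assumes f: "f \<in> L2" and g: "g \<in> L2"
  shows "L2_norm (\<lambda>x. f x - g x) \<le> L2_norm f + L2_norm g"
proof (rule field_le_epsilon)
  fix e :: real assume "0 < e"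
  define A where "A = L2_norm f + e / 2"
  define B where "B = L2_norm g + e / 2"
  have pos: "A > 0" "B > 0"
    using \<open>0 < e\<close> L2_norm_nonneg by (simp_all add: A_def B_def add_nonneg_pos)
  have sq: "(\<integral>x. (k x)\<^sup>2 \<partial>M\<Omega>) = (L2_norm k)\<^sup>2" for k
    by (simp add: L2_norm_def)
  have young: "(u - v)\<^sup>2 \<le> (1 + B / A) * u\<^sup>2 + (1 + A / B) * v\<^sup>2" for u v
  proof -
    have "(1 + B / A) * u\<^sup>2 + (1 + A / B) * v\<^sup>2 - (u - v)\<^sup>2 = (B * u + A * v)\<^sup>2 / (A * B)"
      using pos by (simp add: field_simps power2_eq_square)
    moreover have "0 \<le> (B * u + A * v)\<^sup>2 / (A * B)"
      using pos by simp
    ultimately show ?thesis by linarith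
  qed
  have "(\<integral>x. (f x - g x)\<^sup>2 \<partial>M\<Omega>) \<le> (\<integral>x. (1 + B / A) * (f x)\<^sup>2 + (1 + A / B) * (g x)\<^sup>2 \<partial>M\<Omega>)"
    using L2D[OF f] L2D[OF g] L2D[OF L2_diff[OF f g]] young by (intro integral_mono) auto
  also have "\<dots> = (1 + B / A) * (L2_norm f)\<^sup>2 + (1 + A / B) * (L2_norm g)\<^sup>2"
    using L2D[OF f] L2D[OF g] by (simp add: sq)
  also have "\<dots> \<le> (1 + B / A) * A\<^sup>2 + (1 + A / B) * B\<^sup>2"
    using pos \<open>0 < e\<close> L2_norm_nonneg
    by (intro add_mono mult_left_mono power_mono) (auto simp: A_def B_def)
  also have "\<dots> = (A + B)\<^sup>2"
    using pos by (simp add: field_simps power2_eq_square)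
  finally have "L2_norm (\<lambda>x. f x - g x) \<le> A + B"
    using pos unfolding L2_norm_def by (intro real_le_lsqrt) auto
  then show "L2_norm (\<lambda>x. f x - g x) \<le> L2_norm f + L2_norm g + e"
    by (simp add: A_def B_def)
qed

section \<open>The fundamental lemma of the calculus of variations\<close>

text \<open>Completion does not change the measure of Borel sets, so a countable cover for
  \<open>lborel\<close> also works here.\<close>

lemma sigma_finite_lebesgue: "sigma_finite_measure (lebesgue :: 'a::euclidean_space measure)"
proof
  obtain A :: "'a set set" where "countable A" "A \<subseteq> sets lborel" "\<Union> A = space lborel"
      "\<forall>a\<in>A. emeasure lborel a \<noteq> \<infinity>"
    using lborel.sigma_finite_countable by blast
  then show "\<exists>A::'a set set. countable A \<and> A \<subseteq> sets lebesgue \<and> \<Union> A = space lebesgue \<and>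
      (\<forall>a\<in>A. emeasure lebesgue a \<noteq> \<infinity>)"
    by (intro exI[of _ A]) auto
qed

text \<open>Open intervals form an intersection-stable generator of the Borel sets, so a Dynkin
  argument carries the vanishing integrals to all Borel sets. Null sets then bring in all Lebesgue
  sets, and \<open>density_zero\<close> concludes.\<close>

lemma AE_lebesgue_zero_if_interval_integrals_zero:
  fixes f :: "real \<Rightarrow> real"
  assumes f: "integrable lebesgue f"
    and zero: "\<And>a b. (LINT x:{a<..<b}|lebesgue. f x) = 0"
  shows "AE x in lebesgue. f x = 0"
proof (rule sigma_finite_measure.density_zero[OF sigma_finite_lebesgue f])
  have int: "set_integrable lebesgue B f" if "B \<in> sets lebesgue" for B
    unfolding set_integrable_def using f that by (intro integrable_mult_indicator) auto
  \<comment> \<open>The complement step of the Dynkin induction needs the integral over the whole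
    line, obtained by exhausting it with the intervals (-n, n).\<close>
  have UNIV: "(LINT x:UNIV|lebesgue. f x) = 0"
  proof -
    have U: "(\<Union>n::nat. {- real n<..<real n}) = UNIV"
    proof (intro equalityI subsetI UNIV_I)
      fix x :: real
      obtain n where "\<bar>x\<bar> < real n" using reals_Archimedean2 by blast
      then show "x \<in> (\<Union>n::nat. {- real n<..<real n})" by (auto simp: abs_less_iff intro!: exI[of _ n])
    qed
    have "(\<lambda>n. LINT x:{- real n<..<real n}|lebesgue. f x)
        \<longlonglongrightarrow> (LINT x:(\<Union>n::nat. {- real n<..<real n})|lebesgue. f x)"
      by (rule set_integral_cont_up) (auto simp: incseq_def U intro!: int)
    then show ?thesis
      by (simp add: zero U LIMSEQ_const_iff)
  qed
  have borel: "(LINT x:B|lebesgue. f x) = 0" if "B \<in> sets borel" for B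
  proof -
    have borel_box: "sets borel = sigma_sets UNIV (range (\<lambda>(a, b). box a b :: real set))"
      by (simp add: borel_eq_box)
    have "Int_stable (range (\<lambda>(a, b). box a b :: real set))"
      by (auto simp: Int_stable_def box_Int_box)
    moreover have "range (\<lambda>(a, b). box a b) \<subseteq> Pow (UNIV :: real set)"
      by simp
    moreover have "B \<in> sigma_sets UNIV (range (\<lambda>(a, b). box a b))"
      using that by (simp only: borel_box)
    ultimately show ?thesis
    proof (induction rule: sigma_sets_induct_disjoint)
      case (basic A)
      then show ?case by (auto simp: box_real zero)
    next
      case empty
      then show ?case by (simp add: set_lebesgue_integral_def)
    next
      case (compl A)
      then have "A \<in> sets borel"
        by (simp only: borel_box)
      then have A: "A \<in> sets lebesgue" by simp
      have "(LINT x:A \<union> (UNIV - A)|lebesgue. f x)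
          = (LINT x:A|lebesgue. f x) + (LINT x:UNIV - A|lebesgue. f x)"
        using A by (intro set_integral_Un int) auto
      then show ?case using compl UNIV by simp
    next
      case (union A)
      then have "A i \<in> sets borel" for i
        unfolding borel_box by blast
      then have A: "A i \<in> sets lebesgue" for i by simp
      have "(LINT x:(\<Union>i. A i)|lebesgue. f x) = (\<Sum>i. (LINT x:A i|lebesgue. f x))"
        using A union by (intro lebesgue_integral_countable_add int)
          (auto simp: disjoint_family_on_def)
      then show ?case using union by simp
    qed
  qed
  \<comment> \<open>A Lebesgue set is a Borel set \<open>S\<close> together with part of a null set,
    hence has the same integral as \<open>S\<close>.\<close>
  fix A :: "real set" assume "A \<in> sets lebesgue"
  then obtain S N N' where A: "A = S \<union> N" "N \<subseteq> N'" "N' \<in> null_sets lborel" "S \<in> sets lborel"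
    by (auto elim: sets_completionE)
  have "AE x in lebesgue. x \<notin> N'"
    using A(3) by (intro AE_completion AE_not_in)
  then have "AE x in lebesgue. indicator A x *\<^sub>R f x = indicator S x *\<^sub>R f x"
    by eventually_elim (use A in \<open>auto simp: indicator_def\<close>)
  then have "(LINT x:A|lebesgue. f x) = (LINT x:S|lebesgue. f x)"
    unfolding set_lebesgue_integral_def
    using A \<open>A \<in> sets lebesgue\<close> borel_measurable_integrable[OF f]
    by (intro integral_cong_AE borel_measurable_scaleR borel_measurable_indicator) auto
  then show "(LINT x:A|lebesgue. f x) = 0" using borel A(4) by simp
qed

lemma Omega_ref_lebesgue [simp]: "Omega_ref \<in> sets lebesgue"
  by (simp add: Omega_ref_def)

lemma test_function_continuous:
  assumes "test_function \<phi>"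
  shows "continuous_on S ((deriv ^^ k) \<phi>)"
  using assms differentiable_imp_continuous_on continuous_on_subset
  unfolding test_function_def by blast

lemma test_function_L2:
  assumes "test_function \<phi>"
  shows "(deriv ^^ k) \<phi> \<in> L2"
  by (intro L2_continuous test_function_continuous assms)

lemma fundamental_lemma:
  assumes u: "u \<in> L2" and zero: "\<And>\<phi>. test_function \<phi> \<Longrightarrow> (\<integral>x. u x * \<phi> x \<partial>M\<Omega>) = 0"
  shows "AE x in M\<Omega>. u x = 0"
proof -
  have *: "(\<integral>x. u x * indicator {a<..<b} x \<partial>M\<Omega>) = 0" if "-1 \<le> a" "b \<le> 1" for a b
  proof -
    \<comment> \<open>The index is \<open>Suc n\<close> because \<open>test_function_bump\<close>
      asks for a positive one.\<close>
    have "(\<lambda>n. \<integral>x. u x * bump a b (Suc n) x \<partial>M\<Omega>) \<longlonglongrightarrow> (\<integral>x. u x * indicator {a<..<b} x \<partial>M\<Omega>)"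
    proof (rule integral_dominated_convergence[where w = "\<lambda>x. \<bar>u x\<bar>"])
      show "integrable M\<Omega> (\<lambda>x. \<bar>u x\<bar>)"
        using integrable_L2[OF u] by simp
      show "(\<lambda>x. u x * indicator {a<..<b} x) \<in> borel_measurable M\<Omega>"
        using L2D[OF u]
        by (intro borel_measurable_times measurable_restrict_space1[where f = "indicator _"]
            borel_measurable_indicator) auto
      show "(\<lambda>x. u x * bump a b (Suc n) x) \<in> borel_measurable M\<Omega>" for n
        using L2D[OF u] L2D(1)[OF test_function_L2[OF test_function_bump[OF that, of "Suc n"], of 0]]
        by simp
      show "AE x in M\<Omega>. (\<lambda>n. u x * bump a b (Suc n) x) \<longlonglongrightarrow> u x * indicator {a<..<b} x"
        by (intro AE_I2 tendsto_mult tendsto_const LIMSEQ_Suc bump_tendsto_indicator)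
      show "AE x in M\<Omega>. norm (u x * bump a b (Suc n) x) \<le> \<bar>u x\<bar>" for n
        using abs_bump_le_1 by (auto simp: abs_mult mult_left_le)
    qed
    moreover have "(\<integral>x. u x * bump a b (Suc n) x \<partial>M\<Omega>) = 0" for n
      using that by (intro zero test_function_bump) auto
    ultimately show ?thesis
      by (simp add: LIMSEQ_const_iff)
  qed
  \<comment> \<open>Extension by zero moves the question to the whole line, where the criterion by
    interval integrals is stated.\<close>
  define U where "U x = indicator Omega_ref x * u x" for x
  have U: "integrable lebesgue U"
    using integrable_L2[OF u] unfolding U_def by (simp add: integrable_restrict_space)
  have "(LINT x:{a<..<b}|lebesgue. U x) = 0" for a b
  proof -
    \<comment> \<open>Clipping (a, b) to an open subinterval of the closed reference interval can
      lose only the end points -1 and 1, a null set.\<close>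
    have "AE x in lebesgue. x \<noteq> -1 \<and> x \<noteq> (1::real)"
      by (intro AE_completion AE_conjI AE_lborel_singleton)
    then have "AE x in lebesgue. indicator {a<..<b} x *\<^sub>R U x =
        indicator Omega_ref x *\<^sub>R (u x * indicator {max a (-1)<..<min b 1} x)"
      by eventually_elim (auto simp: U_def Omega_ref_def indicator_def)
    then have "(LINT x:{a<..<b}|lebesgue. U x)
        = (\<integral>x. indicator Omega_ref x *\<^sub>R (u x * indicator {max a (-1)<..<min b 1} x) \<partial>lebesgue)"
      unfolding set_lebesgue_integral_def
    proof (intro integral_cong_AE)
      show "(\<lambda>x. indicat_real {a<..<b} x *\<^sub>R U x) \<in> borel_measurable lebesgue"
        using borel_measurable_integrable[OF U]
        by (intro borel_measurable_scaleR borel_measurable_indicator) auto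
      have "(\<lambda>x. indicat_real {max a (-1)<..<min b 1} x * U x) \<in> borel_measurable lebesgue"
        using borel_measurable_integrable[OF U]
        by (intro borel_measurable_times borel_measurable_indicator) auto
      then show "(\<lambda>x. indicat_real Omega_ref x *\<^sub>R (u x * indicat_real {max a (-1)<..<min b 1} x))
          \<in> borel_measurable lebesgue"
        by (simp add: U_def mult_ac)
    qed auto
    also have "\<dots> = (\<integral>x. u x * indicator {max a (-1)<..<min b 1} x \<partial>M\<Omega>)"
      by (simp add: integral_restrict_space)
    finally show ?thesis using *[of "max a (-1)" "min b 1"] by simp
  qed
  from AE_lebesgue_zero_if_interval_integrals_zero[OF U this]
  have "AE x in lebesgue. x \<in> Omega_ref \<longrightarrow> u x = 0"
    by eventually_elim (auto simp: U_def)
  then show ?thesis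
    by (simp add: AE_restrict_space_iff)
qed


section \<open>Weak derivatives\<close>

text \<open>Tested against the same function, both candidates give the same integral up to the
  common sign (-1)^k, so their difference is orthogonal to all test functions.\<close>

lemma weak_deriv_unique:
  assumes "g \<in> L2" "g' \<in> L2" "has_weak_deriv k f g" "has_weak_deriv k f g'"
  shows "AE x in M\<Omega>. g x = g' x"
proof -
  have "AE x in M\<Omega>. g x - g' x = 0"
  proof (rule fundamental_lemma)
    show "(\<lambda>x. g x - g' x) \<in> L2" using assms by (intro L2_diff)
    fix \<phi> assume \<phi>: "test_function \<phi>"
    have "\<phi> \<in> L2" using test_function_L2[OF \<phi>, of 0] by simp
    moreover have "(\<integral>x. g x * \<phi> x \<partial>M\<Omega>) = (\<integral>x. g' x * \<phi> x \<partial>M\<Omega>)"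
      using assms(3,4) \<phi> by (simp add: has_weak_deriv_def)
    ultimately show "(\<integral>x. (g x - g' x) * \<phi> x \<partial>M\<Omega>) = 0"
      using assms by (simp add: left_diff_distrib integrable_mult_L2)
  qed
  then show ?thesis by simp
qed

lemma weak_deriv:
  assumes "\<exists>g\<in>L2. has_weak_deriv k f g"
  shows "weak_deriv k f \<in> L2" "has_weak_deriv k f (weak_deriv k f)"
  using someI_ex[of "\<lambda>g. g \<in> L2 \<and> has_weak_deriv k f g"] assms
  unfolding weak_deriv_def by blast+

lemma has_weak_deriv_diff:
  assumes "f \<in> L2" "f' \<in> L2" "g \<in> L2" "g' \<in> L2"
    and "has_weak_deriv k f g" "has_weak_deriv k f' g'"
  shows "has_weak_deriv k (\<lambda>x. f x - f' x) (\<lambda>x. g x - g' x)"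
  unfolding has_weak_deriv_def
proof (intro allI impI)
  fix \<phi> assume \<phi>: "test_function \<phi>"
  have L2: "(deriv ^^ k) \<phi> \<in> L2" "\<phi> \<in> L2"
    using test_function_L2[OF \<phi>, of k] test_function_L2[OF \<phi>, of 0] by auto
  show "(\<integral>x. (f x - f' x) * (deriv ^^ k) \<phi> x \<partial>M\<Omega>) = (- 1) ^ k * (\<integral>x. (g x - g' x) * \<phi> x \<partial>M\<Omega>)"
    using assms \<phi> L2
    by (simp add: left_diff_distrib integrable_mult_L2 has_weak_deriv_def right_diff_distrib)
qed

text \<open>This is integration by parts: the fundamental theorem of calculus is applied to the
  product of \<open>f\<close> and the test function.\<close>

lemma has_weak_deriv_C1:
  assumes f: "\<And>x. (f has_real_derivative f' x) (at x)" and f': "continuous_on UNIV f'"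
  shows "has_weak_deriv 1 f f'"
  unfolding has_weak_deriv_def
proof (intro allI impI)
  fix \<phi> assume \<phi>: "test_function \<phi>"
  have D: "(\<phi> has_real_derivative deriv \<phi> x) (at x)" for x
  proof -
    have "(deriv ^^ 0) \<phi> differentiable_on UNIV"
      using \<phi> unfolding test_function_def by blast
    then show ?thesis
      by (simp add: differentiable_on_def DERIV_deriv_iff_real_differentiable)
  qed
  \<comment> \<open>The support lies in the interior of the reference interval, so the boundary
    terms vanish.\<close>
  have ends: "\<phi> (-1) = 0" "\<phi> 1 = 0"
    using \<phi> unfolding test_function_def Omega_ref_def by force+
  have cont: "continuous_on S f" "continuous_on S f'" for S
    using f f' by (auto intro: DERIV_continuous_on continuous_on_subset has_field_derivative_at_within)
  then have L2: "f \<in> L2" "f' \<in> L2" "\<phi> \<in> L2" "deriv \<phi> \<in> L2"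
    using test_function_L2[OF \<phi>, of 0] test_function_L2[OF \<phi>, of 1] by (auto intro: L2_continuous)
  have "((\<lambda>x. f' x * \<phi> x + f x * deriv \<phi> x) has_integral f 1 * \<phi> 1 - f (-1) * \<phi> (-1)) {-1..1}"
    by (intro fundamental_theorem_of_calculus)
      (auto simp: has_real_derivative_iff_has_vector_derivative[symmetric]
        intro!: derivative_eq_intros f[THEN has_field_derivative_at_within]
          D[THEN has_field_derivative_at_within])
  then have "integral Omega_ref (\<lambda>x. f' x * \<phi> x + f x * deriv \<phi> x) = 0"
    by (simp add: ends integral_unique Omega_ref_def)
  moreover have "(\<integral>x. f' x * \<phi> x + f x * deriv \<phi> x \<partial>M\<Omega>)
      = integral Omega_ref (\<lambda>x. f' x * \<phi> x + f x * deriv \<phi> x)"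
    using L2 by (intro lebesgue_integral_eq_integral) (auto simp: integrable_mult_L2)
  ultimately have "(\<integral>x. f' x * \<phi> x \<partial>M\<Omega>) + (\<integral>x. f x * deriv \<phi> x \<partial>M\<Omega>) = 0"
    using L2 by (simp add: integrable_mult_L2)
  then show "(\<integral>x. f x * (deriv ^^ 1) \<phi> x \<partial>M\<Omega>) = (- 1) ^ 1 * (\<integral>x. f' x * \<phi> x \<partial>M\<Omega>)"
    by simp
qed

section \<open>The space of 0-forms\<close>

lemma H\<Lambda>0D:
  assumes "a \<in> H\<Lambda>0"
  shows "a \<in> L2" "weak_deriv 1 a \<in> L2" "has_weak_deriv 1 a (weak_deriv 1 a)"
  using assms weak_deriv[of 1 a] by (auto simp: H\<Lambda>0_def)

lemma H\<Lambda>0_diff: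
  assumes "a \<in> H\<Lambda>0" "b \<in> H\<Lambda>0"
  shows "(\<lambda>x. a x - b x) \<in> H\<Lambda>0"
  using has_weak_deriv_diff[OF H\<Lambda>0D(1)[OF assms(1)] H\<Lambda>0D(1)[OF assms(2)] H\<Lambda>0D(2)[OF assms(1)]
      H\<Lambda>0D(2)[OF assms(2)] H\<Lambda>0D(3)[OF assms(1)] H\<Lambda>0D(3)[OF assms(2)]]
    L2_diff H\<Lambda>0D assms unfolding H\<Lambda>0_def by blast

text \<open>By uniqueness, the derivative chosen for the difference agrees almost everywhere with
  the difference of the chosen derivatives.\<close>

lemma H\<Lambda>0_seminorm_diff_le:
  assumes "a \<in> H\<Lambda>0" "b \<in> H\<Lambda>0"
  shows "H\<Lambda>0_seminorm (\<lambda>x. a x - b x) \<le> H\<Lambda>0_seminorm a + H\<Lambda>0_seminorm b"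
proof -
  note a = H\<Lambda>0D[OF assms(1)] and b = H\<Lambda>0D[OF assms(2)] and ab = H\<Lambda>0D[OF H\<Lambda>0_diff[OF assms]]
  have L2: "(\<lambda>x. weak_deriv 1 a x - weak_deriv 1 b x) \<in> L2"
    by (intro L2_diff a b)
  have "L2_norm (weak_deriv 1 (\<lambda>x. a x - b x)) = L2_norm (\<lambda>x. weak_deriv 1 a x - weak_deriv 1 b x)"
    by (intro L2_norm_cong_AE ab L2 weak_deriv_unique[OF ab(2) L2 ab(3)] has_weak_deriv_diff a b)
  then show ?thesis
    using L2_norm_diff_le[OF a(2) b(2)] by (simp add: H\<Lambda>0_seminorm_def)
qed

text \<open>The triangle inequality is applied twice: to each component, and then in the Euclidean
  plane to the pairs of \<open>L2\<close> norm and semi-norm.\<close>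

lemma H\<Lambda>0_norm_diff_le:
  assumes "a \<in> H\<Lambda>0" "b \<in> H\<Lambda>0"
  shows "H\<Lambda>0_norm (\<lambda>x. a x - b x) \<le> H\<Lambda>0_norm a + H\<Lambda>0_norm b"
proof -
  have "H\<Lambda>0_norm (\<lambda>x. a x - b x)
      \<le> sqrt ((L2_norm a + L2_norm b)\<^sup>2 + (H\<Lambda>0_seminorm a + H\<Lambda>0_seminorm b)\<^sup>2)"
    using L2_norm_diff_le[OF H\<Lambda>0D(1)[OF assms(1)] H\<Lambda>0D(1)[OF assms(2)]]
      H\<Lambda>0_seminorm_diff_le[OF assms] L2_norm_nonneg
    unfolding H\<Lambda>0_norm_def H\<Lambda>0_seminorm_def
    by (intro real_sqrt_le_mono add_mono power_mono) auto
  also have "\<dots> \<le> H\<Lambda>0_norm a + H\<Lambda>0_norm b"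
    unfolding H\<Lambda>0_norm_def H\<Lambda>0_seminorm_def by (rule real_sqrt_sum_squares_triangle_ineq)
  finally show ?thesis .
qed

lemma H\<Lambda>0_seminorm_le_norm: "H\<Lambda>0_seminorm a \<le> H\<Lambda>0_norm a"
  unfolding H\<Lambda>0_seminorm_def H\<Lambda>0_norm_def by (intro real_le_rsqrt) simp

lemma H\<Lambda>0_seminorm_nonneg: "0 \<le> H\<Lambda>0_seminorm a"
  by (simp add: H\<Lambda>0_seminorm_def L2_norm_nonneg)

section \<open>Polynomials and interpolants as 0-forms\<close>

lemma poly_in_H\<Lambda>0: "poly P \<in> H\<Lambda>0"
proof -
  have "has_weak_deriv 1 (poly P) (poly (pderiv P))"
    by (rule has_weak_deriv_C1) (auto intro: poly_DERIV continuous_intros)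
  moreover have "poly Q \<in> L2" for Q
    by (intro L2_continuous continuous_intros)
  ultimately show ?thesis
    unfolding H\<Lambda>0_def by blast
qed

lemma interp_in_H\<Lambda>0: "interp N \<xi> a \<in> H\<Lambda>0"
proof -
  \<comment> \<open>Each Lagrange factor is a scaled linear polynomial, which makes the interpolant
    a polynomial.\<close>
  have "interp N \<xi> a = poly (\<Sum>i\<le>N. smult (cont_rep a (\<xi> i))
      (\<Prod>j\<in>{..N} - {i}. smult (1 / (\<xi> i - \<xi> j)) [:- \<xi> j, 1:]))"
    by (auto simp: interp_def lagrange_def poly_sum poly_prod fun_eq_iff diff_divide_distrib
        intro!: sum.cong prod.cong arg_cong2[of _ _ _ _ "(*)"])
  then show ?thesis by (simp add: poly_in_H\<Lambda>0)
qed

text \<open>An index \<open>r\<close> selects a degree, a grid size and a set of nodes.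
  \<open>C\<close> is quantified before \<open>r\<close>, and \<open>C0\<close> depends on
  \<open>m\<close> only, so the bound is uniform over the whole family.\<close>

theorem proposition29:
  fixes p :: "'i \<Rightarrow> nat" and h :: "'i \<Rightarrow> real" and \<xi> :: "'i \<Rightarrow> nat \<Rightarrow> real"
    and C0 :: "nat \<Rightarrow> real"
  assumes nodes: "\<And>r. interpolation_nodes (p r) (\<xi> r)"
    and grid_size: "\<And>r. 0 < h r"
    and a_priori_estimate:
      "\<And>r m a. 1 \<le> m \<Longrightarrow> m \<le> p r + 1 \<Longrightarrow> a \<in> Sobolev m \<Longrightarrow>
         H\<Lambda>0_norm (\<lambda>x. a x - interp (p r) (\<xi> r) a x)
           \<le> C0 m * (h r ^ (min (p r + 1) m - 1) / real (p r) ^ (m - 1)) * Sobolev_seminorm m a"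
  shows "\<exists>C. \<forall>r. \<forall>a\<in>H\<Lambda>0.
           H\<Lambda>0_norm (interp (p r) (\<xi> r) a) \<le> C * H\<Lambda>0_norm a \<and>
           H\<Lambda>0_seminorm (interp (p r) (\<xi> r) a) \<le> C * H\<Lambda>0_seminorm a"
proof (intro exI allI ballI)
  fix r a assume a: "a \<in> H\<Lambda>0"
  define q where "q = interp (p r) (\<xi> r) a"
  define d where "d = (\<lambda>x. a x - q x)"
  have d: "d \<in> H\<Lambda>0"
    unfolding d_def q_def by (intro H\<Lambda>0_diff a interp_in_H\<Lambda>0)
  \<comment> \<open>The interpolant is \<open>a\<close> minus the error, the form in which the
    triangle inequalities are stated.\<close>
  have q: "q = (\<lambda>x. a x - d x)" by (simp add: d_def)
  have "a \<in> Sobolev 1"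
    using a by (simp add: Sobolev_def H\<Lambda>0_def)
  \<comment> \<open>With m = 1 both exponents are 0. The factor is 1 even for
    \<open>p r = 0\<close>, as \<open>0 ^ 0 = 1\<close>.\<close>
  then have "H\<Lambda>0_norm d \<le> C0 1 * H\<Lambda>0_seminorm a"
    using a_priori_estimate[of 1 r a]
    by (simp add: d_def q_def Sobolev_seminorm_def H\<Lambda>0_seminorm_def)
  \<comment> \<open>No sign of \<open>C0\<close> is assumed; the absolute value makes the later
    monotonicity step valid.\<close>
  also have "\<dots> \<le> \<bar>C0 1\<bar> * H\<Lambda>0_seminorm a"
    by (intro mult_right_mono H\<Lambda>0_seminorm_nonneg) simp
  finally have est: "H\<Lambda>0_norm d \<le> \<bar>C0 1\<bar> * H\<Lambda>0_seminorm a" .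
  have "H\<Lambda>0_norm d \<le> \<bar>C0 1\<bar> * H\<Lambda>0_norm a"
    using est mult_left_mono[OF H\<Lambda>0_seminorm_le_norm, of "\<bar>C0 1\<bar>" a] by simp
  then have "H\<Lambda>0_norm q \<le> (1 + \<bar>C0 1\<bar>) * H\<Lambda>0_norm a"
    using H\<Lambda>0_norm_diff_le[OF a d] by (simp add: q[symmetric] distrib_right)
  \<comment> \<open>The estimate controls the full norm of the error by the semi-norm of
    \<open>a\<close> alone, so no \<open>L2\<close> norm of \<open>a\<close> enters this
    bound.\<close>
  moreover have "H\<Lambda>0_seminorm q \<le> (1 + \<bar>C0 1\<bar>) * H\<Lambda>0_seminorm a"
    using H\<Lambda>0_seminorm_diff_le[OF a d] H\<Lambda>0_seminorm_le_norm[of d] est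
    by (simp add: q[symmetric] distrib_right)
  ultimately show "H\<Lambda>0_norm (interp (p r) (\<xi> r) a) \<le> (1 + \<bar>C0 1\<bar>) * H\<Lambda>0_norm a \<and>
      H\<Lambda>0_seminorm (interp (p r) (\<xi> r) a) \<le> (1 + \<bar>C0 1\<bar>) * H\<Lambda>0_seminorm a"
    by (simp add: q_def)
qed

end
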